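(* For all integers $n\ge 0$ and $i \geq 0$ and all real $x$, the $i$-th derivatives of the Cauchy polynomials can be expressed by $$\frac{d^i c_n(x)}{d x^i} = (-1)^i i! \sum_{m=i}^n \binom{n}{m} \binom{m}{i}\frac{B_{m-i}^{(n+1)}(1-x)}{n+1-m}$$ and $$\frac{d^i \widehat{c}_n(x)}{d x^i} = i! \sum_{m=i}^n (-1)^{n-m} \binom{n}{m} \binom{m}{i}\frac{B_{m-i}^{(n+1)}(x+1)}{n+1-m}.$$
   Context: For real $z$ and integer $n\ge 0$, $\binom{z}{n} = \frac{z(z-1)\cdots(z-n+1)}{n!}$. The Cauchy polynomials of the first and second kind are $c_n(x) = n! \int_{0}^{1} \binom{t - x}{n}\, dt$ and $\widehat{c}_n(x) = n! \int_{0}^{1} \binom{x - t}{n}\, dt$, $n \ge 0$. The generalized (higher-order) Bernoulli polynomials $B_n^{(\alpha)}(x)$ are defined by $\left( \frac{t}{e^t -1}\right)^{\alpha} e^{xt} = \sum_{n=0}^{\infty} B_n^{(\alpha)}(x) \frac{t^n}{n!}$, $|t|<2\pi$. Empty sums (when $i>n$) are $0$. *)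

theory Defs
  imports "HOL-Complex_Analysis.Complex_Analysis"
begin

definition cauchy_poly1 :: "nat \<Rightarrow> real \<Rightarrow> real" where
  "cauchy_poly1 n x = fact n * integral {0..1} (\<lambda>t. (t - x) gchoose n)"

definition cauchy_poly2 :: "nat \<Rightarrow> real \<Rightarrow> real" where
  "cauchy_poly2 n x = fact n * integral {0..1} (\<lambda>t. (x - t) gchoose n)"

(* b is the coefficient sequence of the exponential generating function
   (t / (exp t - 1)) powr a * exp (x * t) on 0 < |t| < 2 * pi.  For real t the base is positive,
   so powr is the ordinary real power.  The removable singularity t = 0 is excluded
   because HOL has 0 / 0 = 0; the lemmas below show that b exists and is unique. *)
definition gen_bernoulli_seq :: "real \<Rightarrow> real \<Rightarrow> (nat \<Rightarrow> real) \<Rightarrow> bool" where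
  "gen_bernoulli_seq a x b \<longleftrightarrow>
     (\<forall>t::real. t \<noteq> 0 \<longrightarrow> \<bar>t\<bar> < 2 * pi \<longrightarrow>
        (\<lambda>n. b n * (t ^ n / fact n)) sums ((t / (exp t - 1)) powr a * exp (x * t)))"

definition gen_bernoulli_poly :: "real \<Rightarrow> nat \<Rightarrow> real \<Rightarrow> real" where
  "gen_bernoulli_poly a n x = (THE b. gen_bernoulli_seq a x b) n"

lemma gen_bernoulli_seq_exists: "\<exists>b. gen_bernoulli_seq a x b"
proof -
  define S where "S = ball (0::complex) (2 * pi)"
  define h where "h = (\<lambda>z::complex. if z = 0 then deriv exp 0 else (exp z - exp 0) / (z - 0))"
  have hol: "h holomorphic_on S"
    unfolding h_def S_def by (rule pole_lemma_open) (auto intro!: holomorphic_intros)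
  have d1: "deriv exp (0::complex) = 1"
    using DERIV_imp_deriv[OF DERIV_exp[of "0::complex"]] by simp
  have nz: "h z \<noteq> 0" if "z \<in> S" for z
  proof (cases "z = 0")
    case False
    have "exp z \<noteq> 1"
    proof
      assume "exp z = 1"
      then obtain n :: int where n: "Re z = 0" "Im z = of_int (2 * n) * pi"
        by (auto simp: exp_eq_1)
      with False have "n \<noteq> 0" by (auto simp: complex_eq_iff)
      then have "1 \<le> \<bar>real_of_int n\<bar>" by linarith
      then have "2 * pi * 1 \<le> 2 * pi * \<bar>real_of_int n\<bar>" by (intro mult_left_mono) auto
      also have "\<dots> = \<bar>Im z\<bar>" using n by (simp add: abs_mult)
      also have "\<dots> \<le> norm z" by (rule abs_Im_le_cmod)
      finally show False using that by (simp add: S_def)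
    qed
    then show ?thesis using False by (simp add: h_def)
  qed (simp add: h_def d1)
  obtain g where g: "g holomorphic_on S" "\<And>z. z \<in> S \<Longrightarrow> h z = exp (g z)"
    using simply_connected_eq_holomorphic_log[of S] convex_imp_simply_connected[of S] hol nz
    by (auto simp: S_def)
  define G where "G = (\<lambda>z. (g z + (cnj \<circ> g \<circ> cnj) z) / 2)"
  have S_cnj: "cnj ` S = S"
    unfolding S_def image_cnj_conv_vimage_cnj by auto
  have "(cnj \<circ> g \<circ> cnj) holomorphic_on S"
    using g(1) by (intro holomorphic_on_compose_cnj_cnj) (simp_all add: S_cnj, simp add: S_def)
  then have Ghol: "G holomorphic_on S"
    unfolding G_def using g(1) by (intro holomorphic_intros) (auto simp: comp_def)
  define F where "F = (\<lambda>z. exp (of_real x * z - of_real a * G z))"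
  have Fhol: "F holomorphic_on S"
    unfolding F_def by (intro holomorphic_intros Ghol)
  define c where "c = (\<lambda>n. (deriv ^^ n) F 0)"
  have Fser: "(\<lambda>n. c n / fact n * z ^ n) sums F z" if "z \<in> S" for z
    using holomorphic_power_series[of F 0 "2 * pi" z] Fhol that by (simp add: S_def c_def)
  have "(\<lambda>n. Re (c n) * (t ^ n / fact n)) sums ((t / (exp t - 1)) powr a * exp (x * t))"
    if t: "t \<noteq> 0" "\<bar>t\<bar> < 2 * pi" for t :: real
  proof -
    have tS: "of_real t \<in> S" using t by (simp add: S_def)
    have "h (of_real t) = of_real ((exp t - 1) / t)"
      using t by (simp add: h_def exp_of_real)
    moreover have pos: "(exp t - 1) / t > 0"
      using t by (cases "t > 0") (auto simp: zero_less_divide_iff)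
    ultimately have "norm (h (of_real t)) = (exp t - 1) / t"
      by (simp only: norm_of_real abs_of_pos)
    then have "exp (Re (g (of_real t))) = (exp t - 1) / t"
      using g(2)[OF tS] by simp
    then have lnG: "Re (g (of_real t)) = ln ((exp t - 1) / t)"
      using pos by (metis ln_exp)
    have "G (of_real t) = of_real (Re (g (of_real t)))"
      by (simp add: G_def complex_eq_iff)
    then have "F (of_real t) = of_real (exp (x * t - a * ln ((exp t - 1) / t)))"
      unfolding F_def lnG by (simp flip: exp_of_real)
    moreover have "exp (x * t - a * ln ((exp t - 1) / t))
        = (t / (exp t - 1)) powr a * exp (x * t)"
    proof -
      have "t / (exp t - 1) = inverse ((exp t - 1) / t)" by simp
      moreover have "ln (inverse ((exp t - 1) / t)) = - ln ((exp t - 1) / t)"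
        by (rule ln_inverse)
      moreover have "t / (exp t - 1) \<noteq> 0" using pos by auto
      ultimately show ?thesis
        by (simp add: powr_def exp_diff exp_minus field_simps)
    qed
    ultimately have "(\<lambda>n. Re (c n / fact n * of_real t ^ n)) sums
        ((t / (exp t - 1)) powr a * exp (x * t))"
      using sums_Re[OF Fser[OF tS]] by simp
    moreover have "Re (c n / fact n * of_real t ^ n) = Re (c n) * (t ^ n / fact n)" for n
    proof -
      have "c n / fact n * of_real t ^ n = c n * of_real (t ^ n / fact n)" by simp
      also have "Re \<dots> = Re (c n) * (t ^ n / fact n)"
        by (simp only: times_complex.sel Re_complex_of_real Im_complex_of_real)
      finally show ?thesis .
    qed
    ultimately show ?thesis by simp
  qed
  then show ?thesis
    unfolding gen_bernoulli_seq_def by (intro exI[of _ "\<lambda>n. Re (c n)"]) auto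
qed

lemma gen_bernoulli_seq_unique:
  assumes "gen_bernoulli_seq a x b" "gen_bernoulli_seq a x b'"
  shows "b = b'"
proof -
  define d where "d = (\<lambda>n. (b n - b' n) / fact n)"
  have d: "(\<lambda>n. d n * t ^ n) sums 0" if "t \<noteq> 0" "norm t < 2 * pi" for t :: real
  proof -
    define r where "r = (t / (exp t - 1)) powr a * exp (x * t)"
    have "(\<lambda>n. b n * (t ^ n / fact n)) sums r" "(\<lambda>n. b' n * (t ^ n / fact n)) sums r"
      using assms that unfolding gen_bernoulli_seq_def r_def by simp_all
    from sums_diff[OF this]
    have "(\<lambda>n. b n * (t ^ n / fact n) - b' n * (t ^ n / fact n)) sums 0" by simp
    also have "(\<lambda>n. b n * (t ^ n / fact n) - b' n * (t ^ n / fact n)) = (\<lambda>n. d n * t ^ n)"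
      by (rule ext) (simp add: d_def diff_divide_distrib left_diff_distrib)
    finally show ?thesis .
  qed
  have "((\<lambda>_::real. 0) \<longlongrightarrow> d 0) (at 0)"
    by (rule powser_limit_0_strong[of "2 * pi"]) (use d in auto)
  then have d0: "d 0 = 0"
    by (simp add: tendsto_const_iff)
  have d': "(\<lambda>n. d n * (t - 0) ^ n) sums 0" if "norm (t - 0) < 2 * pi" for t :: real
    using d[of t] that d0 powser_sums_zero[of d] by (cases "t = 0") auto
  have "d n = 0" for n
  proof (rule ccontr)
    assume n: "d n \<noteq> 0"
    then have "n > 0" using d0 by (cases n) auto
    obtain s :: real where s: "s > 0" "\<And>z::real. z \<in> cball 0 s - {0} \<Longrightarrow> (0::real) \<noteq> 0"
      by (rule powser_0_nonzero[of "2 * pi" 0 d "\<lambda>_. 0" n]) (use d' n \<open>n > 0\<close> in auto)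
    from s(2)[of s] s(1) show False by simp
  qed
  then show ?thesis by (auto simp: d_def)
qed

lemma gen_bernoulli_poly_sums:
  assumes "t \<noteq> 0" "\<bar>t\<bar> < 2 * pi"
  shows "(\<lambda>n. gen_bernoulli_poly a n x * (t ^ n / fact n)) sums
           ((t / (exp t - 1)) powr a * exp (x * t))"
proof -
  have "gen_bernoulli_seq a x (THE b. gen_bernoulli_seq a x b)"
    using gen_bernoulli_seq_exists gen_bernoulli_seq_unique by (metis theI)
  then show ?thesis
    using assms by (simp add: gen_bernoulli_seq_def gen_bernoulli_poly_def)
qed

end

theory Submission
  imports Defs
begin

text \<open>
  Write \<open>B_n^(k)\<close> for the Bernoulli polynomials of order \<open>k\<close>. Comparing coefficients in the
  logarithmic derivative of their generating function gives
  \<open>B_n^(n+1)(x) = (x - n) B_(n-1)^(n)(x)\<close>, hence \<open>B_n^(n+1)(z + 1) = z (z - 1) \<dots> (z - n + 1)\<close>,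
  so the integrands of both Cauchy polynomials are Bernoulli polynomials of order \<open>n + 1\<close>.
  Expanding these by the addition formula in the integration variable and integrating the
  monomials gives the case \<open>i = 0\<close>; the general case follows from
  \<open>d/dx B_m^(k)(x) = m B_(m-1)^(k)(x)\<close>.
\<close>

section \<open>Identity theorem for formal power series\<close>

text \<open>A nonzero power series of positive radius has no zeros in some punctured disc around 0.
  Agreement is asked for only off 0 because the defining expansion of the Bernoulli polynomials says
  nothing at \<open>t = 0\<close>.\<close>

lemma fps_eqI_eventually_at_0:
  fixes F G :: "'a::{real_normed_field,banach} fps"
  assumes F: "fps_conv_radius F > 0" and G: "fps_conv_radius G > 0"
    and eq: "eventually (\<lambda>z. eval_fps F z = eval_fps G z) (at 0)"
  shows "F = G"
proof (rule ccontr)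
  define D where "D = F - G"
  assume "F \<noteq> G"
  then obtain m where m: "fps_nth D m \<noteq> 0"
    by (auto simp: D_def fps_eq_iff)
  have rad: "fps_conv_radius D > 0"
    using fps_conv_radius_diff[of F G] F G unfolding D_def by (auto simp: min_def split: if_splits)
  \<comment> \<open>The bound 1 keeps \<open>c\<close> finite when all radii are infinite, so that
    it is a real \<open>r\<close>.\<close>
  define c where "c = min 1 (min (fps_conv_radius D) (min (fps_conv_radius F) (fps_conv_radius G)))"
  have "c > 0" "c \<noteq> \<infinity>" using rad F G by (auto simp: c_def min_def)
  then obtain r where cr: "c = ereal r" and r: "r > 0"
    by (cases c) auto
  have in_rad: "ereal (norm z) < fps_conv_radius D" "ereal (norm z) < fps_conv_radius F"
    "ereal (norm z) < fps_conv_radius G" if "norm z < r" for z :: 'a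
    using that cr unfolding c_def by (metis less_ereal.simps(1) min_less_iff_conj)+
  have sums: "(\<lambda>n. fps_nth D n * (z - 0) ^ n) sums eval_fps D z" if "norm (z - 0) < r" for z
    using sums_eval_fps[OF in_rad(1)] that by simp
  have "eventually (\<lambda>z. eval_fps D z = 0) (at 0)"
  proof -
    have "eventually (\<lambda>z::'a. norm z < r) (at 0)"
      using r by (auto simp: eventually_at)
    with eq show ?thesis
      by eventually_elim (simp add: D_def eval_fps_diff in_rad)
  qed
  moreover have "eventually (\<lambda>z. eval_fps D z \<noteq> 0) (at 0)"
  proof (cases "eval_fps D 0 = 0")
    case True
    then have "m > 0" using m by (cases m) (auto simp: eval_fps_at_0)
    from powser_0_nonzero[OF r sums True m this]
    obtain s where s: "s > 0" "\<And>z. z \<in> cball 0 s - {0} \<Longrightarrow> eval_fps D z \<noteq> 0"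
      by blast
    then show ?thesis
      by (auto simp: eventually_at intro!: exI[of _ s])
  next
    case False
    have "isCont (eval_fps D) 0"
      using rad by (intro continuous_eval_fps) (simp add: zero_ereal_def)
    then show ?thesis
      using False unfolding isCont_def by (rule tendsto_imp_eventually_ne)
  qed
  ultimately have "eventually (\<lambda>z::'a. False) (at 0)"
    by eventually_elim simp
  then show False by simp
qed

section \<open>Generating series of Bernoulli polynomials of natural order\<close>

text \<open>For natural order \<open>powr\<close> becomes an ordinary power, and the generating
  function can be handled in the ring of formal power series.\<close>

definition bernoulli_fps :: "nat \<Rightarrow> real \<Rightarrow> real fps" where
  "bernoulli_fps k x = Abs_fps (\<lambda>n. gen_bernoulli_poly (real k) n x / fact n)"

lemma bernoulli_fps_nth [simp]:
  "fps_nth (bernoulli_fps k x) n = gen_bernoulli_poly (real k) n x / fact n"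
  by (simp add: bernoulli_fps_def)

lemma bernoulli_fps_sums:
  assumes "t \<noteq> 0" "\<bar>t\<bar> < 2 * pi"
  shows "(\<lambda>n. fps_nth (bernoulli_fps k x) n * t ^ n) sums ((t / (exp t - 1)) ^ k * exp (x * t))"
proof -
  have "t / (exp t - 1) > 0"
    using assms by (cases "t > 0") (auto simp: zero_less_divide_iff)
  then show ?thesis
    using gen_bernoulli_poly_sums[OF assms, of "real k" x] by (simp add: powr_realpow)
qed

lemma fps_conv_radius_bernoulli_fps: "fps_conv_radius (bernoulli_fps k x) > 0"
proof -
  have "summable (\<lambda>n. fps_nth (bernoulli_fps k x) n * 1 ^ n)"
    using bernoulli_fps_sums[of 1 k x] pi_gt3 by (intro sums_summable) auto
  then have "fps_conv_radius (bernoulli_fps k x) \<ge> norm (1::real)"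
    unfolding fps_conv_radius_def by (rule conv_radius_geI)
  then show ?thesis
    by (auto intro: less_le_trans[of _ "ereal 1"])
qed

text \<open>The generating function with its denominator cleared: both sides agree analytically at
  small nonzero \<open>t\<close>. As the factor \<open>(fps_exp 1 - 1) ^ k\<close> can be cancelled,
  this determines \<open>bernoulli_fps k x\<close> and replaces the analytic definition from here
  on.\<close>

lemma bernoulli_fps_mult_power:
  "bernoulli_fps k x * (fps_exp 1 - 1) ^ k = fps_X ^ k * fps_exp x"
proof (rule fps_eqI_eventually_at_0)
  have infE: "fps_conv_radius (fps_exp 1 - 1 :: real fps) = \<infinity>"
    using fps_conv_radius_diff[of "fps_exp 1 :: real fps" 1] by simp
  then have infP: "fps_conv_radius ((fps_exp 1 - 1 :: real fps) ^ k) = \<infinity>"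
    using fps_conv_radius_power[of "fps_exp 1 - 1 :: real fps" k] by simp
  show "fps_conv_radius (bernoulli_fps k x * (fps_exp 1 - 1) ^ k) > 0"
    using fps_conv_radius_mult[of "bernoulli_fps k x" "(fps_exp 1 - 1) ^ k"]
      fps_conv_radius_bernoulli_fps[of k x]
    by (simp add: infP)
  show "fps_conv_radius (fps_X ^ k * fps_exp x) > 0"
    using fps_conv_radius_mult[of "fps_X ^ k" "fps_exp x"] by simp
  obtain r :: real where r: "r > 0" "ereal r < fps_conv_radius (bernoulli_fps k x)"
    using fps_conv_radius_bernoulli_fps[of k x] ereal_dense2 by (metis ereal_less(2))
  have "eventually (\<lambda>t::real. t \<noteq> 0 \<and> \<bar>t\<bar> < min r (2 * pi)) (at 0)"
    using r pi_gt_zero unfolding eventually_at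
    by (intro exI[of _ "min r (2 * pi)"]) (auto simp: dist_norm)
  then show "eventually (\<lambda>t. eval_fps (bernoulli_fps k x * (fps_exp 1 - 1) ^ k) t =
      eval_fps (fps_X ^ k * fps_exp x) t) (at 0)"
  proof eventually_elim
    case (elim t)
    then have rad: "ereal (norm t) < fps_conv_radius (bernoulli_fps k x)"
      using r by (auto intro: less_trans[of _ "ereal r"])
    have "eval_fps (bernoulli_fps k x) t = (t / (exp t - 1)) ^ k * exp (x * t)"
      using sums_unique2[OF sums_eval_fps[OF rad] bernoulli_fps_sums] elim by auto
    then show ?case
      using elim rad
      by (simp add: eval_fps_mult eval_fps_power eval_fps_diff infE infP power_divide)
  qed
qed

lemma fps_exp_1_minus_1_nonzero: "fps_exp 1 - 1 \<noteq> (0 :: real fps)"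
proof
  assume "fps_exp 1 - 1 = (0 :: real fps)"
  then have "fps_nth (fps_exp 1 - 1 :: real fps) 1 = 0" by simp
  then show False by simp
qed

lemma bernoulli_fps_add: "bernoulli_fps k (x + y) = bernoulli_fps k x * fps_exp y"
proof -
  have "bernoulli_fps k (x + y) * (fps_exp 1 - 1) ^ k =
      bernoulli_fps k x * fps_exp y * (fps_exp 1 - 1) ^ k"
    using bernoulli_fps_mult_power[of k "x + y"] bernoulli_fps_mult_power[of k x]
    by (simp add: fps_exp_add_mult mult_ac)
  then show ?thesis
    using fps_exp_1_minus_1_nonzero by simp
qed

text \<open>Coefficients of the Cauchy product in \<open>bernoulli_fps_add\<close>. It serves twice:
  at \<open>x = 0\<close> to exhibit a polynomial, and with \<open>y\<close> a multiple of the
  integration variable.\<close>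

lemma gen_bernoulli_poly_add:
  "gen_bernoulli_poly (real k) n (x + y) =
     (\<Sum>m\<le>n. real (n choose m) * gen_bernoulli_poly (real k) m x * y ^ (n - m))"
proof -
  have "gen_bernoulli_poly (real k) n (x + y) = fact n * fps_nth (bernoulli_fps k (x + y)) n"
    by simp
  also have "\<dots> = (\<Sum>m\<le>n. fact n * (gen_bernoulli_poly (real k) m x / fact m *
      (y ^ (n - m) / fact (n - m))))"
    unfolding bernoulli_fps_add fps_mult_nth sum_distrib_left atLeast0AtMost by simp
  also have "\<dots> = (\<Sum>m\<le>n. real (n choose m) * gen_bernoulli_poly (real k) m x * y ^ (n - m))"
    by (intro sum.cong refl) (simp add: binomial_fact)
  finally show ?thesis .
qed

section \<open>Recurrence in the order and values on the diagonal\<close>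

lemma bernoulli_fps_Suc_mult: "bernoulli_fps (Suc k) x * (fps_exp 1 - 1) = fps_X * bernoulli_fps k x"
proof -
  have "bernoulli_fps (Suc k) x * (fps_exp 1 - 1) * (fps_exp 1 - 1) ^ k =
      fps_X * bernoulli_fps k x * (fps_exp 1 - 1) ^ k"
    using bernoulli_fps_mult_power[of "Suc k" x] bernoulli_fps_mult_power[of k x]
    by (simp add: mult_ac)
  then show ?thesis
    using fps_exp_1_minus_1_nonzero by simp
qed

text \<open>Obtained from the logarithmic derivative of \<open>(t / (exp t - 1)) ^ k * exp (x * t)\<close>,
  since \<open>t * exp t / (exp t - 1) = t + t / (exp t - 1)\<close>.\<close>
lemma bernoulli_fps_order_recurrence:
  "of_nat k * bernoulli_fps (Suc k) x =
     of_nat k * bernoulli_fps k x - fps_X * fps_deriv (bernoulli_fps k x)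
     + (fps_const x - of_nat k) * fps_X * bernoulli_fps k x"
proof (cases k)
  \<comment> \<open>Order 0 is separate because differentiating \<open>k\<close>-th powers below
    involves the exponent \<open>k - 1\<close>.\<close>
  case 0
  have "bernoulli_fps 0 x = fps_exp x"
    using bernoulli_fps_mult_power[of 0 x] by simp
  then show ?thesis by (simp add: 0 mult_ac)
next
  case (Suc j)
  define B where "B = bernoulli_fps k x"
  define C where "C = bernoulli_fps (Suc k) x"
  define E where "E = (fps_exp 1 - 1 :: real fps)"
  define X where "X = (fps_X :: real fps)"
  have dE: "fps_deriv (E ^ k) = of_nat k * (E + 1) * E ^ j"
    by (simp only: fps_deriv_power') (simp add: E_def Suc)
  have dX: "fps_deriv (X ^ k) = of_nat k * X ^ j"
    by (simp only: fps_deriv_power') (simp add: X_def Suc)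
  have B: "B * E ^ k = X ^ k * fps_exp x"
    unfolding B_def E_def X_def by (rule bernoulli_fps_mult_power)
  have C: "C * E = X * B"
    unfolding B_def C_def E_def X_def by (rule bernoulli_fps_Suc_mult)
  have "fps_deriv (B * E ^ k) = fps_deriv (X ^ k * fps_exp x)"
    by (simp only: B)
  then have "B * (of_nat k * (E + 1) * E ^ j) + fps_deriv B * E ^ k =
      X ^ k * (fps_const x * fps_exp x) + of_nat k * X ^ j * fps_exp x"
    by (simp only: fps_deriv_mult dE dX fps_exp_deriv)
  \<comment> \<open>The factor \<open>X * E\<close> turns \<open>E ^ j\<close> and
    \<open>X ^ j\<close> into \<open>k\<close>-th powers, so that \<open>X ^ k * fps_exp x\<close>
    can be traded for \<open>B * E ^ k\<close>.\<close>
  then have "(B * (of_nat k * (E + 1) * E ^ j) + fps_deriv B * E ^ k) * (X * E) =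
      (X ^ k * (fps_const x * fps_exp x) + of_nat k * X ^ j * fps_exp x) * (X * E)"
    by simp
  then have eq: "of_nat k * (X * B) * (E + 1) * E ^ k + X * fps_deriv B * E * E ^ k =
      (X * fps_const x + of_nat k) * E * (B * E ^ k)"
    unfolding B by (simp add: Suc algebra_simps)
  have "(of_nat k * C) * (E * E ^ k) = of_nat k * (C * E) * E ^ k"
    by (simp only: mult_ac)
  \<comment> \<open>Writing 1 as \<open>(E + 1) - E\<close>, and adding and subtracting the term
    with \<open>fps_deriv B\<close>, produces the left side of \<open>eq\<close>.\<close>
  also have "\<dots> = of_nat k * (X * B) * (E + 1) * E ^ k + X * fps_deriv B * E * E ^ k
      - of_nat k * (X * B) * E * E ^ k - X * fps_deriv B * E * E ^ k"
    unfolding C by (simp add: algebra_simps)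
  also have "\<dots> = (of_nat k * B - X * fps_deriv B
     + (fps_const x - of_nat k) * X * B) * (E * E ^ k)"
    unfolding eq by (simp add: algebra_simps)
  finally have "(of_nat k * C) * (E * E ^ k) = (of_nat k * B - X * fps_deriv B
     + (fps_const x - of_nat k) * X * B) * (E * E ^ k)" .
  then show ?thesis
    using fps_exp_1_minus_1_nonzero unfolding B_def C_def E_def X_def by simp
qed

text \<open>At index \<open>k = n + 1\<close> of the order recurrence, the series
  \<open>k * B\<close> and \<open>X * B'\<close> have the same coefficient and cancel; only the term
  with \<open>x - k\<close> survives.\<close>

lemma gen_bernoulli_poly_diagonal_Suc:
  "gen_bernoulli_poly (real (Suc (Suc n))) (Suc n) x =
     (x - real (Suc n)) * gen_bernoulli_poly (real (Suc n)) n x"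
proof -
  have "fps_nth (of_nat (Suc n) * bernoulli_fps (Suc (Suc n)) x) (Suc n) =
      fps_nth (of_nat (Suc n) * bernoulli_fps (Suc n) x - fps_X * fps_deriv (bernoulli_fps (Suc n) x)
     + (fps_const x - of_nat (Suc n)) * fps_X * bernoulli_fps (Suc n) x) (Suc n)"
    by (simp only: bernoulli_fps_order_recurrence)
  also have "(fps_const x - of_nat (Suc n)) * fps_X * bernoulli_fps (Suc n) x =
      fps_const (x - real (Suc n)) * (fps_X * bernoulli_fps (Suc n) x)"
    by (simp only: fps_of_nat[symmetric] fps_const_sub mult.assoc)
  also have "fps_nth (of_nat (Suc n) * bernoulli_fps (Suc n) x -
      fps_X * fps_deriv (bernoulli_fps (Suc n) x) +
      fps_const (x - real (Suc n)) * (fps_X * bernoulli_fps (Suc n) x)) (Suc n) =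
      (x - real (Suc n)) * fps_nth (bernoulli_fps (Suc n) x) n"
    by (simp add: fps_of_nat[symmetric] del: of_nat_Suc bernoulli_fps_nth)
  finally show ?thesis
    by (simp add: fps_of_nat[symmetric] field_simps del: of_nat_Suc)
qed

text \<open>The shift by 1 turns the factor \<open>x - (n + 1)\<close> of the previous recurrence
  into \<open>z - n\<close>, the next factor of the falling factorial.\<close>

lemma gen_bernoulli_poly_diagonal:
  "gen_bernoulli_poly (real (n + 1)) n (z + 1) = fact n * (z gchoose n)"
proof (induction n)
  case 0
  have "bernoulli_fps 1 (z + 1) * (fps_exp 1 - 1) = fps_X * fps_exp (z + 1)"
    using bernoulli_fps_mult_power[of 1 "z + 1"] by simp
  \<comment> \<open>Index 1 is the right one, since \<open>fps_exp 1 - 1\<close> has constant term 0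
    and linear coefficient 1.\<close>
  then have "fps_nth (bernoulli_fps 1 (z + 1) * (fps_exp 1 - 1)) 1 = fps_nth (fps_X * fps_exp (z + 1)) 1"
    by simp
  then show ?case by (simp add: fps_mult_nth)
next
  case (Suc n)
  then show ?case
    using gen_bernoulli_poly_diagonal_Suc[of n "z + 1"] gbinomial_mult_1[of z n]
    by (simp add: algebra_simps)
qed

section \<open>Derivatives\<close>

text \<open>The addition formula at base point 0 shows a polynomial, which is differentiated
  termwise. For \<open>m = 0\<close> the truncated \<open>m - 1\<close> is harmless because of the
  factor \<open>real m\<close>.\<close>

lemma has_real_derivative_gen_bernoulli_poly:
  "(gen_bernoulli_poly (real k) m has_real_derivative
     real m * gen_bernoulli_poly (real k) (m - 1) x) (at x)"
proof -
  have eq: "gen_bernoulli_poly (real k) m =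
      (\<lambda>x. \<Sum>j\<le>m. real (m choose j) * gen_bernoulli_poly (real k) j 0 * x ^ (m - j))" for m
    using gen_bernoulli_poly_add[of k m 0] by auto
  show ?thesis
  proof (cases m)
    case 0
    then show ?thesis by (subst eq) simp
  next
    case (Suc l)
    have "((\<lambda>x. \<Sum>j\<le>m. real (m choose j) * gen_bernoulli_poly (real k) j 0 * x ^ (m - j))
      has_real_derivative (\<Sum>j\<le>m. real (m choose j) * gen_bernoulli_poly (real k) j 0 *
        (real (m - j) * x ^ (m - j - 1)))) (at x)"
      by (auto intro!: derivative_eq_intros sum.cong)
    moreover have "(\<Sum>j\<le>m. real (m choose j) * gen_bernoulli_poly (real k) j 0 *
        (real (m - j) * x ^ (m - j - 1))) =
      (\<Sum>j\<le>l. real (m choose j) * gen_bernoulli_poly (real k) j 0 *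
        (real (m - j) * x ^ (m - j - 1)))"
      by (simp add: Suc)
    moreover have "\<dots> = real m * gen_bernoulli_poly (real k) (m - 1) x"
      unfolding eq[of "m - 1"] sum_distrib_left
    proof (intro sum.cong)
      fix j
      have "real (m choose j) * real (m - j) = real m * real (l choose j)"
        using binomial_absorb_comp[of m j]
        by (simp add: Suc mult_ac flip: of_nat_mult del: mult_Suc mult_Suc_right of_nat_Suc)
      then show "real (m choose j) * gen_bernoulli_poly (real k) j 0 *
        (real (m - j) * x ^ (m - j - 1)) = real m *
        (real (m - 1 choose j) * gen_bernoulli_poly (real k) j 0 * x ^ (m - 1 - j))"
        by (simp add: Suc)
    qed (use Suc in auto)
    ultimately show ?thesis unfolding eq[of m] by simp
  qed
qed

text \<open>The scalar \<open>s\<close> is the slope of an inner affine map, -1 for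
  \<open>1 - x\<close> and 1 for \<open>x + 1\<close>, so one induction serves both kinds. Its step
  rests on \<open>(m choose i) * (m - i) = (i + 1) * (m choose (i + 1))\<close>.\<close>

lemma higher_deriv_appell_sum:
  fixes p :: "nat \<Rightarrow> real \<Rightarrow> real"
  assumes p: "\<And>m x. (p m has_real_derivative s * real m * p (m - 1) x) (at x)"
  shows "(deriv ^^ i) (\<lambda>x. \<Sum>m\<le>n. a m * p m x) =
    (\<lambda>x. s ^ i * fact i * (\<Sum>m=i..n. a m * real (m choose i) * p (m - i) x))"
proof (induction i)
  case 0
  show ?case by (simp add: atLeast0AtMost)
next
  case (Suc i)
  show ?case
  proof (rule ext)
    fix x
    have "((\<lambda>x. s ^ i * fact i * (\<Sum>m=i..n. a m * real (m choose i) * p (m - i) x))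
      has_real_derivative s ^ i * fact i * (\<Sum>m=i..n. a m * real (m choose i) *
        (s * real (m - i) * p (m - i - 1) x))) (at x)"
      by (intro DERIV_cmult DERIV_sum p)
    \<comment> \<open>The term \<open>m = i\<close> is constant in \<open>x\<close>; its derivative
      carries the factor \<open>real (m - i) = 0\<close>.\<close>
    moreover have "(\<Sum>m=i..n. a m * real (m choose i) * (s * real (m - i) * p (m - i - 1) x)) =
      (\<Sum>m=Suc i..n. a m * real (m choose i) * (s * real (m - i) * p (m - i - 1) x))"
      by (intro sum.mono_neutral_right) (auto simp: not_less_eq_eq le_antisym)
    moreover have "\<dots> = s * real (Suc i) * (\<Sum>m=Suc i..n. a m * real (m choose Suc i) * p (m - Suc i) x)"
      unfolding sum_distrib_left
    proof (intro sum.cong refl)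
      fix m
      have "real (m choose i) * real (m - i) = real (Suc i) * real (m choose Suc i)"
        using binomial_absorb_comp[of m i] binomial_absorption[of i m]
        by (simp only: mult.commute flip: of_nat_mult)
      then show "a m * real (m choose i) * (s * real (m - i) * p (m - i - 1) x) =
        s * real (Suc i) * (a m * real (m choose Suc i) * p (m - Suc i) x)"
        by (simp add: mult_ac)
    qed
    ultimately show "(deriv ^^ Suc i) (\<lambda>x. \<Sum>m\<le>n. a m * p m x) x =
      s ^ Suc i * fact (Suc i) * (\<Sum>m=Suc i..n. a m * real (m choose Suc i) * p (m - Suc i) x)"
      by (simp add: Suc.IH DERIV_imp_deriv mult_ac)
  qed
qed

section \<open>Integration over the unit interval\<close>

lemma integral_power_0_1: "((\<lambda>t::real. t ^ k) has_integral 1 / real (Suc k)) {0..1}"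
proof -
  have "((\<lambda>t::real. t ^ k) has_integral 1 ^ Suc k / real (Suc k) - 0 ^ Suc k / real (Suc k)) {0..1}"
  proof (rule fundamental_theorem_of_calculus)
    fix t :: real
    have "((\<lambda>t. t ^ Suc k / real (Suc k)) has_real_derivative t ^ k) (at t within {0..1})"
      by (rule DERIV_cong[OF DERIV_cdivide[OF DERIV_pow]]) (simp del: of_nat_Suc)
    then show "((\<lambda>t. t ^ Suc k / real (Suc k)) has_vector_derivative t ^ k) (at t within {0..1})"
      by (simp only: has_real_derivative_iff_has_vector_derivative)
  qed simp
  then show ?thesis by simp
qed

text \<open>By the diagonal formula the integrand is a Bernoulli polynomial at
  \<open>(y + 1) + c * t\<close>, expanded in powers of \<open>t\<close>. The slope \<open>c\<close>
  is 1 for the first kind and -1 for the second.\<close>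

lemma integral_gbinomial_bernoulli:
  "fact n * integral {0..1} (\<lambda>t. (y + c * t) gchoose n) =
    (\<Sum>m\<le>n. c ^ (n - m) * real (n choose m) / (real n + 1 - real m) *
       gen_bernoulli_poly (real (n + 1)) m (y + 1))"
proof -
  have "fact n * ((y + c * t) gchoose n) =
     (\<Sum>m\<le>n. real (n choose m) * gen_bernoulli_poly (real (n + 1)) m (y + 1) * c ^ (n - m) * t ^ (n - m))"
    for t
    using gen_bernoulli_poly_diagonal[of n "y + c * t"]
      gen_bernoulli_poly_add[of "n + 1" n "y + 1" "c * t"]
    by (simp add: algebra_simps power_mult_distrib)
  then have "fact n * integral {0..1} (\<lambda>t. (y + c * t) gchoose n) =
    integral {0..1} (\<lambda>t. \<Sum>m\<le>n. real (n choose m) *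
       gen_bernoulli_poly (real (n + 1)) m (y + 1) * c ^ (n - m) * t ^ (n - m))"
    by (simp flip: integral_mult_right)
  also have "\<dots> = (\<Sum>m\<le>n. real (n choose m) *
       gen_bernoulli_poly (real (n + 1)) m (y + 1) * c ^ (n - m) * (1 / real (Suc (n - m))))"
    by (intro integral_unique has_integral_sum has_integral_mult_right integral_power_0_1) auto
  \<comment> \<open>Since \<open>m \<le> n\<close>, the truncated \<open>Suc (n - m)\<close> equals
    the real number \<open>n + 1 - m\<close>.\<close>
  also have "\<dots> = (\<Sum>m\<le>n. c ^ (n - m) * real (n choose m) / (real n + 1 - real m) *
       gen_bernoulli_poly (real (n + 1)) m (y + 1))"
    by (intro sum.cong) (auto simp: of_nat_diff algebra_simps)
  finally show ?thesis .
qed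

theorem theorem5:
  fixes n i :: nat and x :: real
  shows "(deriv ^^ i) (cauchy_poly1 n) x =
           (-1) ^ i * fact i *
           (\<Sum>m=i..n. real (n choose m) * real (m choose i) *
              (gen_bernoulli_poly (real (n + 1)) (m - i) (1 - x) / (real n + 1 - real m))) \<and>
         (deriv ^^ i) (cauchy_poly2 n) x =
           fact i *
           (\<Sum>m=i..n. (-1) ^ (n - m) * real (n choose m) * real (m choose i) *
              (gen_bernoulli_poly (real (n + 1)) (m - i) (x + 1) / (real n + 1 - real m)))"
proof
  let ?B = "gen_bernoulli_poly (real (n + 1))"
  \<comment> \<open>Here \<open>y = - x\<close>, so the argument \<open>y + 1\<close> is
    \<open>1 - x\<close>.\<close>
  have c1: "cauchy_poly1 n =
      (\<lambda>x. \<Sum>m\<le>n. real (n choose m) / (real n + 1 - real m) * ?B m (1 - x))"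
    using integral_gbinomial_bernoulli[of n "- x" 1 for x]
    by (auto simp: cauchy_poly1_def fun_eq_iff)
  have d1: "((\<lambda>x. ?B m (1 - x)) has_real_derivative - 1 * real m * ?B (m - 1) (1 - x)) (at x)" for m x
    by (rule DERIV_cong[OF DERIV_chain2[OF has_real_derivative_gen_bernoulli_poly]])
       (auto intro!: derivative_eq_intros)
  show "(deriv ^^ i) (cauchy_poly1 n) x = (-1) ^ i * fact i *
      (\<Sum>m=i..n. real (n choose m) * real (m choose i) *
         (?B (m - i) (1 - x) / (real n + 1 - real m)))"
    unfolding c1 higher_deriv_appell_sum[of "\<lambda>m x. ?B m (1 - x)", OF d1] by simp
  \<comment> \<open>The alternating sign comes from \<open>c = -1\<close> in the integrand;
    differentiation adds none, as \<open>x + 1\<close> has slope 1.\<close>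
  have c2: "cauchy_poly2 n =
      (\<lambda>x. \<Sum>m\<le>n. (-1) ^ (n - m) * real (n choose m) / (real n + 1 - real m) * ?B m (x + 1))"
    using integral_gbinomial_bernoulli[of n x "-1" for x]
    by (auto simp: cauchy_poly2_def fun_eq_iff)
  have d2: "((\<lambda>x. ?B m (x + 1)) has_real_derivative 1 * real m * ?B (m - 1) (x + 1)) (at x)" for m x
    by (rule DERIV_cong[OF DERIV_chain2[OF has_real_derivative_gen_bernoulli_poly]])
       (auto intro!: derivative_eq_intros)
  show "(deriv ^^ i) (cauchy_poly2 n) x = fact i *
      (\<Sum>m=i..n. (-1) ^ (n - m) * real (n choose m) * real (m choose i) *
         (?B (m - i) (x + 1) / (real n + 1 - real m)))"
    unfolding c2 higher_deriv_appell_sum[of "\<lambda>m x. ?B m (x + 1)", OF d2] by simp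
qed

end
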